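(* Let $0<c<1$ be a constant, let $k\geq 1$ be a constant integer, let $t=cn$ and $t'=t-k$, and let $q=q(c,k)>0$ be a large enough constant (depending only on $c$ and $k$). Let $\Delta\sim\mathcal{RP}(n,t,p)$. Then: 1. Suppose $k>1$ and let $C=\frac{\alpha(c)\,k!}{(1-c)^k}$. If $p=\frac{1}{n^{k-1}}\left(C+q(1-c)^{-k}k!\,\frac{\log n}{n}\right)$, then $\Delta$ has a complete $t'$-skeleton with high probability. If instead $p=\frac{1}{n^{k-1}}\left(C-q(1-c)^{-k}k!\,\frac{\log n}{n}\right)$, then with high probability $\Delta$ does not have a complete $t'$-skeleton. 2. Suppose $k=1$. If $p=1-\exp\left(\frac{-\alpha(c)}{1-c}-\frac{q\log n}{(1-c)n}\right)$, then $\Delta$ has a complete $t'$-skeleton with high probability. If instead $p=1-\exp\left(\frac{-\alpha(c)}{1-c}+\frac{q\log n}{(1-c)n}\right)$, then with high probability $\Delta$ does not have a complete $t'$-skeleton.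
   Context: $\log$ is the natural logarithm and $\alpha(c)=-c\log c-(1-c)\log(1-c)$. "With high probability" means with probability tending to $1$ as $n\to\infty$ (through $n$ for which $cn$ is an integer). A simplicial complex on $n$ vertices is a collection $\Delta$ of non-empty subsets (faces) of $[n]=\{1,\dots,n\}$ closed under taking non-empty subsets. For $0\le p\le 1$, the random pure simplicial complex $\Delta\sim\mathcal{RP}(n,t,p)$ is generated by choosing each subset of $[n]$ of size $t$ to be a facet of $\Delta$ independently with probability $p$, and letting $\Delta$ consist of all non-empty subsets of the chosen $t$-sets. $\Delta$ has a complete $k$-skeleton if every non-empty subset of $[n]$ of size (cardinality) at most $k$ is a face of $\Delta$ (size, not dimension, is used here). *)

theory Defs
  imports "HOL-Probability.Probability"
begin

definition abstract_simplicial_complex :: "nat \<Rightarrow> nat set set \<Rightarrow> bool" where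
  "abstract_simplicial_complex n \<Delta> \<longleftrightarrow>
     (\<forall>\<sigma>\<in>\<Delta>. \<sigma> \<noteq> {} \<and> \<sigma> \<subseteq> {1..n}) \<and>
     (\<forall>\<sigma>\<in>\<Delta>. \<forall>\<tau>. \<tau> \<noteq> {} \<and> \<tau> \<subseteq> \<sigma> \<longrightarrow> \<tau> \<in> \<Delta>)"

definition subsets_of_size :: "nat \<Rightarrow> nat \<Rightarrow> nat set set" where
  "subsets_of_size n t = {S. S \<subseteq> {1..n} \<and> card S = t}"

definition generated_complex :: "nat set set \<Rightarrow> nat set set" where
  "generated_complex \<F> = {\<sigma>. \<sigma> \<noteq> {} \<and> (\<exists>S\<in>\<F>. \<sigma> \<subseteq> S)}"

text \<open>
  The model is meant for \<open>0 \<le> p \<le> 1\<close>; \<^const>\<open>bernoulli_pmf\<close> truncates other values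
  of \<open>p\<close> to this interval. \<^const>\<open>Pi_pmf\<close> gives independent coins, one for each
  \<open>t\<close>-subset of \<open>{1..n}\<close>.
\<close>

definition random_pure_complex :: "nat \<Rightarrow> nat \<Rightarrow> real \<Rightarrow> nat set set pmf" where
  "random_pure_complex n t p =
     map_pmf (\<lambda>coin. generated_complex {S \<in> subsets_of_size n t. coin S})
       (Pi_pmf (subsets_of_size n t) False (\<lambda>_. bernoulli_pmf p))"

text \<open>The skeleton is indexed by cardinality, not by dimension.\<close>

definition complete_skeleton :: "nat \<Rightarrow> nat \<Rightarrow> nat set set \<Rightarrow> bool" where
  "complete_skeleton n m \<Delta> \<longleftrightarrow>
     (\<forall>\<sigma>. \<sigma> \<noteq> {} \<and> \<sigma> \<subseteq> {1..n} \<and> card \<sigma> \<le> m \<longrightarrow> \<sigma> \<in> \<Delta>)"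

lemma abstract_simplicial_complex_generated_complex:
  assumes "\<F> \<subseteq> Pow {1..n}"
  shows "abstract_simplicial_complex n (generated_complex \<F>)"
  using assms unfolding abstract_simplicial_complex_def generated_complex_def by blast

lemma abstract_simplicial_complex_random_pure_complex:
  assumes "\<Delta> \<in> set_pmf (random_pure_complex n t p)"
  shows "abstract_simplicial_complex n \<Delta>"
proof -
  obtain coin where \<Delta>: "\<Delta> = generated_complex {S \<in> subsets_of_size n t. coin S}"
    using assms unfolding random_pure_complex_def set_map_pmf by blast
  show ?thesis
    unfolding \<Delta> by (rule abstract_simplicial_complex_generated_complex) (auto simp: subsets_of_size_def)
qed

definition entropy_fun :: "real \<Rightarrow> real" where
  "entropy_fun c = - c * ln c - (1 - c) * ln (1 - c)"

text \<open>
  The limit is taken along those \<open>n\<close> for which \<open>c * n\<close> is an integer; it holds vacuously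
  if \<open>c\<close> is irrational.
\<close>

definition with_high_probability ::
    "real \<Rightarrow> (nat \<Rightarrow> 'a pmf) \<Rightarrow> (nat \<Rightarrow> 'a \<Rightarrow> bool) \<Rightarrow> bool" where
  "with_high_probability c X P \<longleftrightarrow>
     ((\<lambda>n. measure_pmf.prob (X n) {x. P n x}) \<longlongrightarrow> 1)
       (inf sequentially (principal {n. c * real n \<in> \<int>}))"

end

theory Submission
  imports Defs "HOL-Real_Asymp.Real_Asymp"
begin

text \<open>
  Let \<open>X\<close> count the sets of size \<open>t' = t - k\<close> contained in no chosen \<open>t\<close>-set; each such set lies in
  \<open>M = (n - t + k) choose k\<close> sets of size \<open>t\<close>, so \<open>E X = (n choose t') (1 - p) ^ M\<close>. Since
  \<open>n choose t'\<close> is \<open>exp (\<alpha>(c) n)\<close> up to a power of \<open>n\<close>, and \<open>(1 - p) ^ M\<close> is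
  \<open>exp (- \<alpha>(c) n)\<close> times \<open>n powr - q\<close> or \<open>n powr q\<close>, the first case follows from the union bound.
  In the second, Chebyshev's inequality applies: two events are independent unless the union of
  the two \<open>t'\<close>-sets has at most \<open>t\<close> elements, which for a given first set allows only
  \<open>O(n ^ (2 * k))\<close> second sets. Bounding these covariances trivially leaves
  \<open>P(X = 0) \<le> O(n ^ (2 * k)) / E X\<close>, so it suffices to take \<open>q\<close> large compared with \<open>3 * k\<close>.
\<close>

subsection \<open>First and second moment bounds\<close>

lemma prob_no_coin:
  assumes "finite A" "F \<subseteq> A" "0 \<le> p" "p \<le> 1"
  shows "measure_pmf.prob (Pi_pmf A False (\<lambda>_. bernoulli_pmf p)) {f. \<forall>x\<in>F. \<not> f x} = (1 - p) ^ card F"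
proof -
  \<comment> \<open>As a product set, with no restriction outside \<open>F\<close>, the event has a
    probability that factorises over the coins.\<close>
  have "{f. \<forall>x\<in>F. \<not> f x} = Pi A (\<lambda>x. if x \<in> F then {False} else UNIV)"
    using assms(2) by (auto simp: Pi_def split: if_splits)
  then have "measure_pmf.prob (Pi_pmf A False (\<lambda>_. bernoulli_pmf p)) {f. \<forall>x\<in>F. \<not> f x}
     = (\<Prod>x\<in>A. measure_pmf.prob (bernoulli_pmf p) (if x \<in> F then {False} else UNIV))"
    using assms(1) by (simp add: measure_Pi_pmf_Pi)
  also have "\<dots> = (\<Prod>x\<in>A. if x \<in> F then 1 - p else 1)"
    using assms(3,4) by (intro prod.cong) (auto simp: measure_pmf_single)
  also have "\<dots> = (\<Prod>x\<in>F. 1 - p)"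
    using assms(1,2) by (simp add: prod.If_cases Int_absorb1)
  finally show ?thesis by simp
qed

text \<open>A superset \<open>S\<close> is determined by \<open>S - \<sigma>\<close>, an arbitrary
  \<open>(t - m)\<close>-subset of the complement of \<open>\<sigma>\<close>. For
  \<open>m = t - k\<close> the count is the exponent \<open>(n - t + k) choose k\<close>, called
  \<open>M\<close> above.\<close>

lemma card_supersets_of_size:
  assumes "\<sigma> \<in> subsets_of_size n m" "m \<le> t"
  shows "card {S \<in> subsets_of_size n t. \<sigma> \<subseteq> S} = (n - m) choose (t - m)"
proof -
  have fin: "finite \<sigma>" and sub: "\<sigma> \<subseteq> {1..n}" and card: "card \<sigma> = m"
    using assms(1) finite_subset by (auto simp: subsets_of_size_def)
  have "bij_betw (\<lambda>B. \<sigma> \<union> B) {B. B \<subseteq> {1..n} - \<sigma> \<and> card B = t - m} {S \<in> subsets_of_size n t. \<sigma> \<subseteq> S}"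
  proof (intro bij_betw_byWitness[where f' = "\<lambda>S. S - \<sigma>"] ballI subsetI)
    fix S assume "S \<in> (\<lambda>B. \<sigma> \<union> B) ` {B. B \<subseteq> {1..n} - \<sigma> \<and> card B = t - m}"
    then obtain B where B: "S = \<sigma> \<union> B" "B \<subseteq> {1..n} - \<sigma>" "card B = t - m" by blast
    then have "card S = t"
      using fin card assms(2) finite_subset[of B "{1..n} - \<sigma>"]
      by (subst B(1), subst card_Un_disjoint) auto
    then show "S \<in> {S \<in> subsets_of_size n t. \<sigma> \<subseteq> S}"
      using B sub by (auto simp: subsets_of_size_def)
  next
    fix B assume "B \<in> (\<lambda>S. S - \<sigma>) ` {S \<in> subsets_of_size n t. \<sigma> \<subseteq> S}"
    then show "B \<in> {B. B \<subseteq> {1..n} - \<sigma> \<and> card B = t - m}"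
      using fin card by (auto simp: subsets_of_size_def card_Diff_subset)
  qed auto
  then have "card {S \<in> subsets_of_size n t. \<sigma> \<subseteq> S} = card {B. B \<subseteq> {1..n} - \<sigma> \<and> card B = t - m}"
    by (rule bij_betw_same_card[symmetric])
  also have "\<dots> = (n - m) choose (t - m)"
    using n_subsets[of "{1..n} - \<sigma>" "t - m"] fin sub card by (simp add: card_Diff_subset)
  finally show ?thesis .
qed

lemma finite_subsets_of_size [simp]: "finite (subsets_of_size n t)"
  by (rule finite_subset[of _ "Pow {1..n}"]) (auto simp: subsets_of_size_def)

lemma card_subsets_of_size: "card (subsets_of_size n m) = n choose m"
  using n_subsets[of "{1..n}" m] by (simp add: subsets_of_size_def)

text \<open>Any smaller set extends to an \<open>m\<close>-set inside \<open>{1..n}\<close>, and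
  faces are closed under non-empty subsets, so size exactly \<open>m\<close> decides. Positivity of
  \<open>m\<close> keeps the empty set, never a face, out of the right-hand side.\<close>

lemma complete_skeleton_generated_complex_iff:
  assumes "0 < m" "m \<le> n"
  shows "complete_skeleton n m (generated_complex \<F>) \<longleftrightarrow>
    (\<forall>\<sigma>\<in>subsets_of_size n m. \<exists>S\<in>\<F>. \<sigma> \<subseteq> S)"
proof
  assume *: "complete_skeleton n m (generated_complex \<F>)"
  show "\<forall>\<sigma>\<in>subsets_of_size n m. \<exists>S\<in>\<F>. \<sigma> \<subseteq> S"
  proof
    fix \<sigma> assume "\<sigma> \<in> subsets_of_size n m"
    then have "\<sigma> \<noteq> {}" "\<sigma> \<subseteq> {1..n}" "card \<sigma> = m"
      using assms(1) by (auto simp: subsets_of_size_def)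
    then have "\<sigma> \<in> generated_complex \<F>"
      using * unfolding complete_skeleton_def by blast
    then show "\<exists>S\<in>\<F>. \<sigma> \<subseteq> S" by (simp add: generated_complex_def)
  qed
next
  assume *: "\<forall>\<sigma>\<in>subsets_of_size n m. \<exists>S\<in>\<F>. \<sigma> \<subseteq> S"
  show "complete_skeleton n m (generated_complex \<F>)"
    unfolding complete_skeleton_def
  proof (intro allI impI, elim conjE)
    fix \<sigma> assume \<sigma>: "\<sigma> \<noteq> {}" "\<sigma> \<subseteq> {1..n}" "card \<sigma> \<le> m"
    then obtain \<tau> where \<tau>: "\<sigma> \<subseteq> \<tau>" "\<tau> \<subseteq> {1..n}" "card \<tau> = m"
      using exists_subset_between[of \<sigma> m "{1..n}"] assms(2) by auto
    then obtain S where "S \<in> \<F>" "\<tau> \<subseteq> S"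
      using * by (auto simp: subsets_of_size_def)
    with \<sigma> \<tau> show "\<sigma> \<in> generated_complex \<F>"
      unfolding generated_complex_def by blast
  qed
qed

text \<open>For fixed \<open>\<sigma>\<close>, the set \<open>\<tau>\<close> can be recovered from
  the pair \<open>(\<sigma> - \<tau>, \<tau> - \<sigma>)\<close>. If the union has at most
  \<open>t\<close> elements, both differences have at most \<open>k\<close>, and there are at most
  \<open>(k + 1) * n ^ k\<close> such subsets of \<open>{1..n}\<close>.\<close>

lemma card_close_subsets_le:
  assumes "\<sigma> \<in> subsets_of_size n (t - k)" "0 < n"
  shows "card {\<tau> \<in> subsets_of_size n (t - k). card (\<sigma> \<union> \<tau>) \<le> t} \<le> ((k + 1) * n ^ k)\<^sup>2"
proof -
  let ?K = "{B. B \<subseteq> {1..n} \<and> card B \<le> k}"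
  let ?R = "{\<tau> \<in> subsets_of_size n (t - k). card (\<sigma> \<union> \<tau>) \<le> t}"
  have fin: "finite ?K" by simp
  have "?K = (\<Union>j\<le>k. subsets_of_size n j)"
    by (auto simp: subsets_of_size_def)
  then have "card ?K \<le> (\<Sum>j\<le>k. card (subsets_of_size n j))"
    by (simp add: card_UN_le)
  also have "\<dots> \<le> (\<Sum>j\<le>k. n ^ k)"
  proof (rule sum_mono)
    fix j assume j: "j \<in> {..k}"
    have "n choose j \<le> n ^ j"
      using binomial_le_pow[of j n] by (cases "j \<le> n") (auto simp: binomial_eq_0)
    also have "\<dots> \<le> n ^ k" using j assms(2) by (intro power_increasing) auto
    finally show "card (subsets_of_size n j) \<le> n ^ k" by (simp add: card_subsets_of_size)
  qed
  finally have K: "card ?K \<le> (k + 1) * n ^ k" by simp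
  have "card ?R \<le> card (?K \<times> ?K)"
  proof (rule card_inj_on_le[where f = "\<lambda>\<tau>. (\<sigma> - \<tau>, \<tau> - \<sigma>)"])
    show "inj_on (\<lambda>\<tau>. (\<sigma> - \<tau>, \<tau> - \<sigma>)) ?R" by (auto simp: inj_on_def)
    show "(\<lambda>\<tau>. (\<sigma> - \<tau>, \<tau> - \<sigma>)) ` ?R \<subseteq> ?K \<times> ?K"
    proof clarsimp
      fix \<tau> assume \<tau>: "\<tau> \<in> subsets_of_size n (t - k)" and le: "card (\<sigma> \<union> \<tau>) \<le> t"
      have f: "finite \<sigma>" "finite \<tau>" "\<sigma> \<subseteq> {1..n}" "\<tau> \<subseteq> {1..n}" "card \<sigma> = t - k" "card \<tau> = t - k"
        using assms \<tau> finite_subset by (auto simp: subsets_of_size_def)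
      have "card (\<sigma> \<union> \<tau>) = card \<tau> + card (\<sigma> - \<tau>)" "card (\<sigma> \<union> \<tau>) = card \<sigma> + card (\<tau> - \<sigma>)"
        using f card_Un_disjoint[of \<tau> "\<sigma> - \<tau>"] card_Un_disjoint[of \<sigma> "\<tau> - \<sigma>"]
        by (auto simp: Un_commute)
      then show "\<sigma> - \<tau> \<subseteq> {Suc 0..n} \<and> card (\<sigma> - \<tau>) \<le> k \<and> \<tau> - \<sigma> \<subseteq> {Suc 0..n} \<and> card (\<tau> - \<sigma>) \<le> k"
        using f le by auto
    qed
  qed (use fin in simp)
  also have "\<dots> = (card ?K)\<^sup>2" by (simp add: card_cartesian_product power2_eq_square)
  also have "\<dots> \<le> ((k + 1) * n ^ k)\<^sup>2" using K by (rule power_mono) simp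
  finally show ?thesis .
qed

text \<open>Chebyshev's inequality for the number \<open>X\<close> of events that occur.
  \<open>R\<close> marks the pairs that may be dependent, at most \<open>D\<close> for each event,
  so the variance is at most \<open>D * \<mu>\<close> and
  \<open>P(X = 0) \<le> D / \<mu>\<close>.\<close>

lemma (in prob_space) prob_no_event_le:
  fixes \<pi> D :: real
  assumes fin: "finite I" and ne: "I \<noteq> {}"
    and E: "\<And>i. i \<in> I \<Longrightarrow> E i \<in> events"
    and prob: "\<And>i. i \<in> I \<Longrightarrow> prob (E i) = \<pi>" and pos: "\<pi> > 0"
    and indep: "\<And>i j. i \<in> I \<Longrightarrow> j \<in> I \<Longrightarrow> \<not> R i j \<Longrightarrow> prob (E i \<inter> E j) = \<pi>\<^sup>2"
    and R: "\<And>i. i \<in> I \<Longrightarrow> real (card {j \<in> I. R i j}) \<le> D"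
  shows "prob {x \<in> space M. \<forall>i\<in>I. x \<notin> E i} \<le> D / (card I * \<pi>)"
proof -
  define X where "X = (\<lambda>x. \<Sum>i\<in>I. indicator (E i) x :: real)"
  define \<mu> where "\<mu> = card I * \<pi>"
  let ?A = "{x \<in> space M. \<forall>i\<in>I. x \<notin> E i}"
  have \<mu>: "\<mu> > 0" using fin ne pos by (simp add: \<mu>_def card_gt_0_iff)
  have A: "?A \<in> events"
    using fin E by measurable
  have int1: "integrable M (\<lambda>x. indicator (E i) x :: real)" if "i \<in> I" for i
    using E[OF that] by (simp add: integrable_real_indicator emeasure_eq_measure)
  have int2: "integrable M (\<lambda>x. indicator (E i \<inter> E j) x :: real)" if "i \<in> I" "j \<in> I" for i j
    using E that by (simp add: integrable_real_indicator emeasure_eq_measure sets.Int)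
  have intX: "integrable M X" using int1 by (simp add: X_def)
  have X2: "X x ^ 2 = (\<Sum>i\<in>I. \<Sum>j\<in>I. indicator (E i \<inter> E j) x)" for x
    by (simp add: X_def power2_eq_square sum_product indicator_inter_arith)
  have intX2: "integrable M (\<lambda>x. X x ^ 2)" unfolding X2 using int2 by simp
  have EX: "expectation X = \<mu>"
    using int1 E prob by (simp add: X_def \<mu>_def)
  have "expectation (\<lambda>x. X x ^ 2) = (\<Sum>i\<in>I. \<Sum>j\<in>I. prob (E i \<inter> E j))"
    unfolding X2 using int2 E by (simp add: sets.Int)
  also have "\<dots> \<le> (\<Sum>i\<in>I. card I * \<pi>\<^sup>2 + D * \<pi>)"
  proof (rule sum_mono)
    fix i assume i: "i \<in> I"
    have "(\<Sum>j\<in>I. prob (E i \<inter> E j)) \<le> (\<Sum>j\<in>I. \<pi>\<^sup>2 + (if R i j then \<pi> else 0))"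
    proof (rule sum_mono)
      fix j assume j: "j \<in> I"
      \<comment> \<open>For related pairs the joint probability is bounded by that of a single
        event; this also covers the diagonal.\<close>
      have "prob (E i \<inter> E j) \<le> \<pi>"
        using finite_measure_mono[of "E i \<inter> E j" "E i"] E i prob by auto
      then show "prob (E i \<inter> E j) \<le> \<pi>\<^sup>2 + (if R i j then \<pi> else 0)"
        using indep[OF i j] by (auto intro: add_increasing)
    qed
    also have "\<dots> = card I * \<pi>\<^sup>2 + card {j \<in> I. R i j} * \<pi>"
      using fin by (simp add: sum.distrib sum.If_cases Int_def)
    also have "\<dots> \<le> card I * \<pi>\<^sup>2 + D * \<pi>"
      using R[OF i] pos by (simp add: mult_right_mono)
    finally show "(\<Sum>j\<in>I. prob (E i \<inter> E j)) \<le> card I * \<pi>\<^sup>2 + D * \<pi>" .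
  qed
  also have "\<dots> = \<mu>\<^sup>2 + D * \<mu>"
    by (simp add: \<mu>_def power2_eq_square algebra_simps)
  finally have EX2: "expectation (\<lambda>x. X x ^ 2) \<le> \<mu>\<^sup>2 + D * \<mu>" .
  \<comment> \<open>Where no event occurs, \<open>X = 0\<close> and \<open>(X - \<mu>)\<close>
    squared equals \<open>\<mu>\<close> squared; elsewhere the square is non-negative. Integrating
    this pointwise bound is Chebyshev's argument.\<close>
  have "prob ?A * \<mu>\<^sup>2 = expectation (\<lambda>x. \<mu>\<^sup>2 * indicator ?A x)"
    using A by simp
  also have "\<dots> \<le> expectation (\<lambda>x. X x ^ 2 - 2 * \<mu> * X x + \<mu>\<^sup>2)"
  proof (rule integral_mono)
    show "integrable M (\<lambda>x. \<mu>\<^sup>2 * indicator ?A x)"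
      using A by (simp add: integrable_real_indicator emeasure_eq_measure)
    show "integrable M (\<lambda>x. X x ^ 2 - 2 * \<mu> * X x + \<mu>\<^sup>2)" using intX intX2 by simp
    fix x
    have "X x = 0" if "x \<in> ?A" using that by (simp add: X_def)
    moreover have "X x ^ 2 - 2 * \<mu> * X x + \<mu>\<^sup>2 = (X x - \<mu>)\<^sup>2"
      by (simp add: power2_eq_square algebra_simps)
    ultimately show "\<mu>\<^sup>2 * indicator ?A x \<le> X x ^ 2 - 2 * \<mu> * X x + \<mu>\<^sup>2"
      by (cases "x \<in> ?A") auto
  qed
  also have "\<dots> = expectation (\<lambda>x. X x ^ 2) - 2 * \<mu> * \<mu> + \<mu>\<^sup>2"
    using intX intX2 EX by (simp add: prob_space)
  also have "\<dots> \<le> D * \<mu>" using EX2 by (simp add: power2_eq_square)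
  finally have "prob ?A * \<mu> \<le> D" using \<mu> by (simp add: power2_eq_square)
  then show ?thesis using \<mu> by (simp add: \<mu>_def pos_le_divide_eq)
qed

section \<open>The moment bounds for the random pure complex\<close>

lemma not_complete_skeleton_generated_complex_eq:
  assumes "0 < m" "m \<le> n"
  shows "{coin. \<not> complete_skeleton n m (generated_complex {S \<in> subsets_of_size n t. coin S})} =
    (\<Union>\<sigma>\<in>subsets_of_size n m. {coin. \<forall>S\<in>{S \<in> subsets_of_size n t. \<sigma> \<subseteq> S}. \<not> coin S})"
  unfolding complete_skeleton_generated_complex_iff[OF assms] by auto

lemma prob_not_complete_skeleton_le:
  assumes "0 \<le> p" "p \<le> 1" "k < t" "t \<le> n"
  shows "measure_pmf.prob (random_pure_complex n t p) {\<Delta>. \<not> complete_skeleton n (t - k) \<Delta>}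
    \<le> real (n choose (t - k)) * (1 - p) ^ ((n - t + k) choose k)"
proof -
  let ?P = "Pi_pmf (subsets_of_size n t) False (\<lambda>_. bernoulli_pmf p)"
  let ?F = "\<lambda>\<sigma>. {S \<in> subsets_of_size n t. \<sigma> \<subseteq> S}"
  let ?E = "\<lambda>\<sigma>. {coin. \<forall>S\<in>?F \<sigma>. \<not> coin S}"
  have "measure_pmf.prob (random_pure_complex n t p) {\<Delta>. \<not> complete_skeleton n (t - k) \<Delta>}
    = measure_pmf.prob ?P (\<Union>\<sigma>\<in>subsets_of_size n (t - k). ?E \<sigma>)"
    unfolding random_pure_complex_def measure_map_pmf vimage_def mem_Collect_eq
    using assms(3,4) by (subst not_complete_skeleton_generated_complex_eq) auto
  also have "\<dots> \<le> (\<Sum>\<sigma>\<in>subsets_of_size n (t - k). measure_pmf.prob ?P (?E \<sigma>))"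
    by (rule measure_pmf.finite_measure_subadditive_finite) auto
  also have "\<dots> = (\<Sum>\<sigma>\<in>subsets_of_size n (t - k). (1 - p) ^ ((n - t + k) choose k))"
  proof (rule sum.cong[OF refl])
    fix \<sigma> assume "\<sigma> \<in> subsets_of_size n (t - k)"
    then have "card (?F \<sigma>) = (n - t + k) choose k"
      using assms(3,4) by (simp add: card_supersets_of_size)
    then show "measure_pmf.prob ?P (?E \<sigma>) = (1 - p) ^ ((n - t + k) choose k)"
      using assms by (subst prob_no_coin) auto
  qed
  finally show ?thesis by (simp add: card_subsets_of_size)
qed

text \<open>Second moment bound with the uncovered \<open>(t - k)\<close>-sets as events. Pairs
  whose union has at most \<open>t\<close> elements count as related; \<open>p < 1\<close> makes the
  common probability positive.\<close>

lemma prob_complete_skeleton_le: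
  assumes "0 \<le> p" "p < 1" "k < t" "t \<le> n"
  shows "measure_pmf.prob (random_pure_complex n t p) {\<Delta>. complete_skeleton n (t - k) \<Delta>}
    \<le> real (((k + 1) * n ^ k)\<^sup>2) / (real (n choose (t - k)) * (1 - p) ^ ((n - t + k) choose k))"
proof -
  let ?P = "Pi_pmf (subsets_of_size n t) False (\<lambda>_. bernoulli_pmf p)"
  let ?I = "subsets_of_size n (t - k)"
  let ?F = "\<lambda>\<sigma>. {S \<in> subsets_of_size n t. \<sigma> \<subseteq> S}"
  let ?E = "\<lambda>\<sigma>. {coin. \<forall>S\<in>?F \<sigma>. \<not> coin S}"
  let ?M = "(n - t + k) choose k"
  have card_F: "card (?F \<sigma>) = ?M" if "\<sigma> \<in> ?I" for \<sigma>
    using assms(3,4) that by (simp add: card_supersets_of_size)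
  have "{coin. complete_skeleton n (t - k) (generated_complex {S \<in> subsets_of_size n t. coin S})}
      = - (\<Union>\<sigma>\<in>?I. ?E \<sigma>)"
    using assms(3,4) by (subst not_complete_skeleton_generated_complex_eq[symmetric]) auto
  then have "measure_pmf.prob (random_pure_complex n t p) {\<Delta>. complete_skeleton n (t - k) \<Delta>}
    = measure_pmf.prob ?P {coin \<in> space ?P. \<forall>\<sigma>\<in>?I. coin \<notin> ?E \<sigma>}"
    unfolding random_pure_complex_def measure_map_pmf vimage_def mem_Collect_eq
    by (intro arg_cong[where f = "measure_pmf.prob ?P"]) auto
  also have "\<dots> \<le> real (((k + 1) * n ^ k)\<^sup>2) / (card ?I * (1 - p) ^ ?M)"
  proof (rule measure_pmf.prob_no_event_le[where R = "\<lambda>\<sigma> \<tau>. card (\<sigma> \<union> \<tau>) \<le> t"])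
    show "?I \<noteq> {}"
      using assms(3,4) card_subsets_of_size[of n "t - k"] by (metis binomial_eq_0_iff card.empty diff_le_self le_trans not_le)
    show "measure_pmf.prob ?P (?E \<sigma>) = (1 - p) ^ ?M" if "\<sigma> \<in> ?I" for \<sigma>
      using assms card_F[OF that] by (subst prob_no_coin) auto
    show "0 < (1 - p) ^ ?M" using assms by simp
    show "measure_pmf.prob ?P (?E \<sigma> \<inter> ?E \<tau>) = ((1 - p) ^ ?M)\<^sup>2"
      if "\<sigma> \<in> ?I" "\<tau> \<in> ?I" "\<not> card (\<sigma> \<union> \<tau>) \<le> t" for \<sigma> \<tau>
    proof -
      \<comment> \<open>A common \<open>t\<close>-superset would contain the union, which has more
        than \<open>t\<close> elements. The two events thus depend on disjoint sets of coins,
        \<open>2 * M\<close> in all.\<close>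
      have "?F \<sigma> \<inter> ?F \<tau> = {}"
      proof (rule ccontr)
        assume "?F \<sigma> \<inter> ?F \<tau> \<noteq> {}"
        then obtain S where "S \<subseteq> {1..n}" "card S = t" "\<sigma> \<union> \<tau> \<subseteq> S"
          by (auto simp: subsets_of_size_def)
        then have "card (\<sigma> \<union> \<tau>) \<le> t" using card_mono[of S "\<sigma> \<union> \<tau>"] finite_subset by auto
        with that(3) show False by simp
      qed
      then have "card (?F \<sigma> \<union> ?F \<tau>) = 2 * ?M"
        using card_F that by (subst card_Un_disjoint) auto
      moreover have "?E \<sigma> \<inter> ?E \<tau> = {coin. \<forall>S\<in>?F \<sigma> \<union> ?F \<tau>. \<not> coin S}" by auto
      ultimately show ?thesis
        using assms by (simp only:) (subst prob_no_coin, auto simp: power_mult mult.commute power2_eq_square power_add mult_2)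
    qed
    show "real (card {\<tau> \<in> ?I. card (\<sigma> \<union> \<tau>) \<le> t}) \<le> real (((k + 1) * n ^ k)\<^sup>2)" if "\<sigma> \<in> ?I" for \<sigma>
      using card_close_subsets_le[OF that] assms by (intro of_nat_mono) simp
  qed auto
  finally show ?thesis by (simp add: card_subsets_of_size)
qed

subsection \<open>Binomial coefficients and entropy\<close>

text \<open>Entropy as the exponential rate of \<open>c ^ t * (1 - c) ^ (n - t)\<close>. Both
  estimates of the binomial coefficient use entropy through this identity.\<close>

lemma exp_entropy_fun:
  assumes "0 < c" "c < 1" "real t = c * real n"
  shows "exp (entropy_fun c * real n) * (c ^ t * (1 - c) ^ (n - t)) = 1"
proof -
  have "t \<le> n" using assms mult_right_mono[of c 1 "real n"] by simp
  then have n: "real (n - t) = (1 - c) * real n" using assms(3) by (simp add: of_nat_diff algebra_simps)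
  have "c ^ t = exp (c * real n * ln c)" "(1 - c) ^ (n - t) = exp ((1 - c) * real n * ln (1 - c))"
    using assms n by (simp_all flip: exp_of_nat_mult n assms(3) add: exp_of_nat_mult)
  then show ?thesis by (simp flip: exp_add add: entropy_fun_def algebra_simps)
qed

text \<open>The term of index \<open>t - k\<close> in the expansion of
  \<open>(c + (1 - c)) ^ n = 1\<close> is at most 1. Replacing its weight by the weight at index
  \<open>t\<close> costs the factor \<open>(c / (1 - c)) ^ k\<close>.\<close>

lemma choose_le_exp_entropy:
  assumes "0 < c" "c < 1" "real t = c * real n" "k \<le> t"
  shows "real (n choose (t - k)) \<le> (c / (1 - c)) ^ k * exp (entropy_fun c * real n)"
proof -
  have tn: "t \<le> n" using assms mult_right_mono[of c 1 "real n"] by simp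
  have "real (n choose (t - k)) * c ^ (t - k) * (1 - c) ^ (n - (t - k)) \<le> (c + (1 - c)) ^ n"
    unfolding binomial_ring using assms tn
    by (intro member_le_sum[where f = "\<lambda>j. real (n choose j) * c ^ j * (1 - c) ^ (n - j)"]) auto
  then have "real (n choose (t - k)) * (c ^ (t - k) * (1 - c) ^ (n - (t - k))) \<le> 1"
    by (simp add: mult.assoc)
  moreover have "c ^ (t - k) = c ^ t / c ^ k" "(1 - c) ^ (n - (t - k)) = (1 - c) ^ (n - t) * (1 - c) ^ k"
    using assms tn by (auto simp: power_diff simp flip: power_add)
  ultimately have "real (n choose (t - k)) * (c ^ t * (1 - c) ^ (n - t)) * ((1 - c) / c) ^ k \<le> 1"
    by (simp add: power_divide mult_ac)
  then have "exp (entropy_fun c * real n) * (real (n choose (t - k)) * (c ^ t * (1 - c) ^ (n - t)) * ((1 - c) / c) ^ k)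
      \<le> exp (entropy_fun c * real n)"
    by simp
  moreover have "exp (entropy_fun c * real n) * (real (n choose (t - k)) * (c ^ t * (1 - c) ^ (n - t)) * ((1 - c) / c) ^ k)
    = real (n choose (t - k)) * ((1 - c) / c) ^ k * (exp (entropy_fun c * real n) * (c ^ t * (1 - c) ^ (n - t)))"
    by simp
  ultimately have "real (n choose (t - k)) * ((1 - c) / c) ^ k \<le> exp (entropy_fun c * real n)"
    unfolding exp_entropy_fun[OF assms(1-3)] by simp
  then show ?thesis using assms by (simp add: power_divide field_simps)
qed

lemma power_self_le_fact_exp: "real n ^ n \<le> fact n * exp (real n)"
proof -
  \<comment> \<open>One term of the exponential series at \<open>n\<close>.\<close>
  have "(\<Sum>j\<in>{n}. real n ^ j /\<^sub>R fact j) \<le> exp (real n)"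
    using exp_converges[of "real n"] by (intro sum_le_suminf[THEN order_trans]) (auto simp: sums_iff)
  then show ?thesis by (simp add: field_simps)
qed

text \<open>A crude Stirling upper bound, by induction. The step needs
  \<open>exp 1 * n ^ (n + 1) \<le> (n + 1) ^ (n + 1)\<close>, which is
  \<open>1 + x \<le> exp x\<close> at \<open>x = - 1 / (n + 1)\<close> raised to the power
  \<open>n + 1\<close>.\<close>

lemma fact_exp_le:
  assumes "n > 0"
  shows "fact n * exp (real n) \<le> exp 1 * real n * real n ^ n"
  using assms
proof (induction n rule: nat_induct_non_zero)
  case (Suc n)
  have "1 - 1 / real (Suc n) \<le> exp (- 1 / real (Suc n))"
    using exp_ge_add_one_self[of "- 1 / real (Suc n)"] by simp
  then have "(1 - 1 / real (Suc n)) ^ Suc n \<le> exp (- 1 / real (Suc n)) ^ Suc n"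
    by (intro power_mono) auto
  also have "\<dots> = exp (- 1)"
    by (simp only: exp_of_nat_mult[symmetric]) simp
  also have "1 - 1 / real (Suc n) = real n / real (Suc n)" by (simp add: field_simps)
  finally have "exp 1 * real n ^ Suc n \<le> real (Suc n) ^ Suc n"
    by (simp only: power_divide exp_minus) (simp add: pos_divide_le_eq inverse_eq_divide pos_le_divide_eq mult_ac del: power_Suc of_nat_Suc)
  then have "exp 1 * real (Suc n) * (exp 1 * real n ^ Suc n) \<le> exp 1 * real (Suc n) * real (Suc n) ^ Suc n"
    by (intro mult_left_mono) auto
  moreover have "fact (Suc n) * exp (real (Suc n)) = exp 1 * real (Suc n) * (fact n * exp (real n))"
    by (simp add: exp_add algebra_simps)
  moreover have "\<dots> \<le> exp 1 * real (Suc n) * (exp 1 * real n * real n ^ n)"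
    using Suc by (intro mult_left_mono) auto
  ultimately show ?case by (simp add: mult_ac)
qed simp

text \<open>Stirling's bounds, from below for \<open>n!\<close> and from above for \<open>t!\<close>
  and \<open>(n - t)!\<close>, show that \<open>n choose t\<close> is at least
  \<open>exp (\<alpha>(c) n)\<close> up to the factor \<open>exp 2 * n ^ 2\<close>. Passing from
  \<open>t\<close> to \<open>t - k\<close> costs another \<open>n ^ k\<close>.\<close>

lemma exp_entropy_le_choose:
  assumes "0 < c" "c < 1" "real t = c * real n" "k \<le> t" "0 < n"
  shows "exp (entropy_fun c * real n) \<le> exp 2 * real n ^ (k + 2) * real (n choose (t - k))"
proof -
  have t0: "0 < t" using assms by (metis of_nat_0_less_iff mult_pos_pos)
  have "real t < real n" using assms mult_strict_right_mono[of c 1 "real n"] by simp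
  then have tn: "t < n" by simp
  let ?C = "real (n choose t)"
  have nt: "real (n - t) = (1 - c) * real n" using assms(3) tn by (simp add: of_nat_diff algebra_simps)
  have "real n ^ n \<le> fact n * exp (real n)" by (rule power_self_le_fact_exp)
  also have "\<dots> = ?C * ((fact t * exp (real t)) * (fact (n - t) * exp (real (n - t))))"
  proof -
    have "fact n = fact t * fact (n - t) * ?C"
      using arg_cong[OF binomial_fact_lemma[of t n], of real] tn by simp
    moreover have "exp (real n) = exp (real t) * exp (real (n - t))"
      using tn by (simp flip: exp_add of_nat_add)
    ultimately show ?thesis by (simp only: mult_ac)
  qed
  also have "\<dots> \<le> ?C * ((exp 1 * real t * real t ^ t) * (exp 1 * real (n - t) * real (n - t) ^ (n - t)))"
    using t0 tn by (intro mult_left_mono mult_mono fact_exp_le) auto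
  also have "\<dots> = ?C * exp 2 * (real t * real (n - t)) * (real t ^ t * real (n - t) ^ (n - t))"
    by (simp flip: exp_add add: mult_ac)
  also have "real t ^ t * real (n - t) ^ (n - t) = c ^ t * (1 - c) ^ (n - t) * real n ^ n"
  proof -
    have "real n ^ n = real n ^ t * real n ^ (n - t)" using tn by (simp flip: power_add)
    then show ?thesis unfolding nt assms(3) by (simp add: power_mult_distrib)
  qed
  finally have "real n ^ n * 1 \<le> real n ^ n * (?C * exp 2 * (real t * real (n - t)) * (c ^ t * (1 - c) ^ (n - t)))"
    by (simp add: mult_ac)
  then have "1 \<le> ?C * exp 2 * (real t * real (n - t)) * (c ^ t * (1 - c) ^ (n - t))"
    by (rule mult_left_le_imp_le) (use assms(5) in simp)
  then have "exp (entropy_fun c * real n) * 1 \<le> exp (entropy_fun c * real n) *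
      (?C * exp 2 * (real t * real (n - t)) * (c ^ t * (1 - c) ^ (n - t)))"
    by (rule mult_left_mono) simp
  also have "\<dots> = ?C * exp 2 * (real t * real (n - t)) * (exp (entropy_fun c * real n) * (c ^ t * (1 - c) ^ (n - t)))"
    by (simp only: mult_ac)
  also have "\<dots> = ?C * exp 2 * (real t * real (n - t))"
    unfolding exp_entropy_fun[OF assms(1-3)] by simp
  also have "\<dots> \<le> ?C * exp 2 * (real n * real n)"
    using tn by (intro mult_left_mono mult_mono) auto
  also have "?C \<le> real (n choose (t - k)) * real n ^ k"
  proof -
    \<comment> \<open>Pairs of a \<open>t\<close>-set and a \<open>(t - k)\<close>-subset of it are
      counted in both orders.\<close>
    have "n choose t \<le> (n choose t) * (t choose (t - k))" by (simp add: Suc_le_eq)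
    also have "\<dots> = (n choose (t - k)) * ((n - (t - k)) choose k)"
      using choose_mult[of "t - k" t n] assms(4) tn by simp
    also have "\<dots> \<le> (n choose (t - k)) * (n - (t - k)) ^ k"
      using assms(4) tn by (intro mult_left_mono binomial_le_pow) auto
    also have "\<dots> \<le> (n choose (t - k)) * n ^ k" by (intro mult_left_mono power_mono) auto
    finally show ?thesis by (metis of_nat_le_iff of_nat_mult of_nat_power)
  qed
  finally show ?thesis by (simp add: power_add power2_eq_square mult_ac mult_right_mono)
qed

text \<open>The right-hand side is the product of \<open>N + 1, ..., N + k\<close>, each factor at
  least \<open>N\<close>. The induction peels off one factor by absorption. For
  \<open>N = n - t\<close> this bounds \<open>M\<close> from below.\<close>

lemma power_le_choose_add: "real N ^ k \<le> fact k * real ((N + k) choose k)"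
proof (induction k)
  case (Suc k)
  have "fact (Suc k) * real ((N + Suc k) choose Suc k) = fact k * real (Suc k * (Suc (N + k) choose Suc k))"
    by (simp add: algebra_simps del: binomial_Suc_Suc)
  also have "\<dots> = real (Suc (N + k)) * (fact k * real ((N + k) choose k))"
    by (simp only: Suc_times_binomial) (simp add: algebra_simps)
  also have "\<dots> \<ge> real N * real N ^ k"
    using Suc by (intro mult_mono) auto
  finally show ?case by simp
qed simp

subsection \<open>Asymptotics at the threshold\<close>

abbreviation integral_multiples :: "real \<Rightarrow> nat filter" where
  "integral_multiples c \<equiv> inf sequentially (principal {n. c * real n \<in> \<int>})"

lemma eventually_integral_multiplesI:
  assumes "eventually P sequentially"
  shows "eventually P (integral_multiples c)"
  using assms by (rule filter_leD[OF inf_le1])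

text \<open>Along this filter \<open>c * n\<close> is an integer, so the floor defining
  \<open>t\<close> is exact. The strict inequalities make \<open>t - k\<close> and
  \<open>n - t\<close> positive.\<close>

lemma eventually_floor_integral_multiples:
  assumes "0 < c" "c < 1"
  shows "\<forall>\<^sub>F n in integral_multiples c.
    real (nat \<lfloor>c * real n\<rfloor>) = c * real n \<and> k < nat \<lfloor>c * real n\<rfloor> \<and> nat \<lfloor>c * real n\<rfloor> < n"
proof -
  have "\<forall>\<^sub>F n in sequentially. real k < c * real n"
    using assms by real_asymp
  then show ?thesis unfolding eventually_inf_principal
  proof eventually_elim
    case (elim n)
    show ?case
    proof
      assume "n \<in> {n. c * real n \<in> \<int>}"
      then have *: "real (nat \<lfloor>c * real n\<rfloor>) = c * real n"
        using assms by (auto elim!: Ints_cases)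
      have "0 < n" using elim by (cases n) auto
      then have "c * real n < real n" using assms by simp
      with elim have "real k < real (nat \<lfloor>c * real n\<rfloor>)" "real (nat \<lfloor>c * real n\<rfloor>) < real n"
        unfolding * by simp_all
      then have "k < nat \<lfloor>c * real n\<rfloor>" "nat \<lfloor>c * real n\<rfloor> < n"
        by (simp_all only: of_nat_less_iff)
      with * show "real (nat \<lfloor>c * real n\<rfloor>) = c * real n \<and> k < nat \<lfloor>c * real n\<rfloor> \<and> nat \<lfloor>c * real n\<rfloor> < n"
        by blast
    qed
  qed
qed

text \<open>The bound \<open>f\<close> need only hold along the restricted filter, while its limit
  may be computed over all \<open>n\<close>.\<close>

lemma with_high_probabilityI:
  assumes "\<forall>\<^sub>F n in integral_multiples c. measure_pmf.prob (X n) {x. \<not> P n x} \<le> f n"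
    and "f \<longlonglongrightarrow> 0"
  shows "with_high_probability c X P"
  unfolding with_high_probability_def
proof (rule tendsto_sandwich[where h = "\<lambda>_. 1"])
  have "((\<lambda>n. 1 - f n) \<longlongrightarrow> 1 - 0) (integral_multiples c)"
    using tendsto_mono[OF inf_le1 assms(2)] by (intro tendsto_intros)
  then show "((\<lambda>n. 1 - f n) \<longlongrightarrow> 1) (integral_multiples c)" by simp
  show "\<forall>\<^sub>F n in integral_multiples c. 1 - f n \<le> measure_pmf.prob (X n) {x. P n x}"
    using assms(1)
  proof eventually_elim
    case (elim n)
    have "{x. P n x} = space (X n) - {x. \<not> P n x}" by auto
    then show ?case using elim measure_pmf.prob_compl[of "{x. \<not> P n x}" "X n"] by simp
  qed
qed (auto intro!: always_eventually tendsto_const)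

text \<open>First moment half, with \<open>p\<close> entering only through an upper bound on
  \<open>(1 - p) ^ M\<close>, so that it serves \<open>k > 1\<close> and \<open>k = 1\<close> alike.
  The exponentials cancel and a multiple of \<open>n powr - q\<close> remains.\<close>

lemma with_high_probability_complete_skeleton:
  assumes c: "0 < c" "c < 1" and t: "\<And>n. t n = nat \<lfloor>c * real n\<rfloor>" and "q > 0"
    and p: "\<forall>\<^sub>F n in integral_multiples c. 0 \<le> p n \<and> p n \<le> 1 \<and>
      (1 - p n) ^ ((n - t n + k) choose k) \<le> exp (- (entropy_fun c * real n) - q * ln (real n))"
  shows "with_high_probability c (\<lambda>n. random_pure_complex n (t n) (p n))
    (\<lambda>n \<Delta>. complete_skeleton n (t n - k) \<Delta>)"
proof (rule with_high_probabilityI)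
  show "\<forall>\<^sub>F n in integral_multiples c.
    measure_pmf.prob (random_pure_complex n (t n) (p n)) {\<Delta>. \<not> complete_skeleton n (t n - k) \<Delta>}
      \<le> (c / (1 - c)) ^ k * exp (- q * ln (real n))"
    using p eventually_floor_integral_multiples[OF c, of k]
  proof eventually_elim
    case (elim n)
    then have "measure_pmf.prob (random_pure_complex n (t n) (p n)) {\<Delta>. \<not> complete_skeleton n (t n - k) \<Delta>}
      \<le> real (n choose (t n - k)) * (1 - p n) ^ ((n - t n + k) choose k)"
      by (intro prob_not_complete_skeleton_le) (auto simp: t)
    also have "\<dots> \<le> (c / (1 - c)) ^ k * exp (entropy_fun c * real n) * exp (- (entropy_fun c * real n) - q * ln (real n))"
      using elim c by (intro mult_mono choose_le_exp_entropy) (auto simp: t)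
    also have "\<dots> = (c / (1 - c)) ^ k * exp (- q * ln (real n))"
      by (simp add: mult.assoc flip: exp_add)
    finally show ?case .
  qed
  have "(\<lambda>n. exp (- q * ln (real n))) \<longlonglongrightarrow> 0" using \<open>q > 0\<close> by real_asymp
  then show "(\<lambda>n. (c / (1 - c)) ^ k * exp (- q * ln (real n))) \<longlonglongrightarrow> 0"
    by (rule tendsto_mult_right_zero)
qed

text \<open>Second moment half. The constant \<open>3 * k + 3\<close> adds up \<open>2 * k\<close>
  for the dependent pairs, \<open>k + 2\<close> for the loss in the entropy bound and 1 to make the
  quotient tend to 0. \<open>B\<close> allows for a bounded loss in the exponent.\<close>

lemma with_high_probability_not_complete_skeleton:
  assumes c: "0 < c" "c < 1" and t: "\<And>n. t n = nat \<lfloor>c * real n\<rfloor>" and q: "q \<ge> 3 * real k + 3"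
    and p: "\<forall>\<^sub>F n in integral_multiples c. 0 \<le> p n \<and> p n < 1 \<and>
      exp (- (entropy_fun c * real n) + q * ln (real n) - B) \<le> (1 - p n) ^ ((n - t n + k) choose k)"
  shows "with_high_probability c (\<lambda>n. random_pure_complex n (t n) (p n))
    (\<lambda>n \<Delta>. \<not> complete_skeleton n (t n - k) \<Delta>)"
proof (rule with_high_probabilityI)
  \<comment> \<open>This is \<open>((k + 1) * n ^ k) ^ 2\<close> divided by the lower bound
    \<open>n ^ (2 * k + 1) / exp (B + 2)\<close> for the expected number of uncovered sets.\<close>
  let ?f = "\<lambda>n. (real k + 1)\<^sup>2 * exp (B + 2) * (1 / real n)"
  show "\<forall>\<^sub>F n in integral_multiples c.
    measure_pmf.prob (random_pure_complex n (t n) (p n)) {\<Delta>. \<not> \<not> complete_skeleton n (t n - k) \<Delta>} \<le> ?f n"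
    using p eventually_floor_integral_multiples[OF c, of k]
  proof eventually_elim
    case (elim n)
    let ?\<mu> = "real (n choose (t n - k)) * (1 - p n) ^ ((n - t n + k) choose k)"
    have n: "real n > 0" "n > 0" using elim by auto
    have "real n ^ (2 * k + 1) * real n ^ (k + 2) = exp ((3 * real k + 3) * ln (real n))"
    proof -
      have "real n ^ (2 * k + 1) * real n ^ (k + 2) = real n ^ (3 * k + 3)"
        unfolding power_add[symmetric] by (rule arg_cong) simp
      also have "\<dots> = exp (real (3 * k + 3) * ln (real n))"
        using n by (simp only: exp_of_nat_mult exp_ln)
      finally show ?thesis by simp
    qed
    also have "\<dots> \<le> exp (q * ln (real n))"
      using q n by (simp add: mult_right_mono)
    also have "\<dots> = exp B * (exp (entropy_fun c * real n) * exp (- (entropy_fun c * real n) + q * ln (real n) - B))"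
      by (simp flip: exp_add)
    also have "\<dots> \<le> exp B * ((exp 2 * real n ^ (k + 2) * real (n choose (t n - k))) * (1 - p n) ^ ((n - t n + k) choose k))"
      using elim c n by (intro mult_left_mono mult_mono exp_entropy_le_choose) (auto simp: t)
    also have "\<dots> = exp (B + 2) * ?\<mu> * real n ^ (k + 2)"
      by (simp add: exp_add)
    finally have "real n ^ (2 * k + 1) \<le> exp (B + 2) * ?\<mu>"
      using n by (simp add: mult_le_cancel_right_pos)
    then have \<mu>: "real n ^ (2 * k) * real n \<le> exp (B + 2) * ?\<mu>" by (simp add: mult_ac)
    moreover have "0 < real n ^ (2 * k) * real n" using n by simp
    ultimately have "0 < exp (B + 2) * ?\<mu>" by linarith
    then have \<mu>0: "0 < ?\<mu>" by (simp add: zero_less_mult_iff)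
    have "measure_pmf.prob (random_pure_complex n (t n) (p n)) {\<Delta>. complete_skeleton n (t n - k) \<Delta>}
      \<le> real (((k + 1) * n ^ k)\<^sup>2) / ?\<mu>"
      using elim by (intro prob_complete_skeleton_le) (auto simp: t)
    also have "real (((k + 1) * n ^ k)\<^sup>2) = (real k + 1)\<^sup>2 * real n ^ (2 * k)"
      by (simp only: of_nat_power of_nat_mult of_nat_add of_nat_1 power_mult_distrib
          power_mult[symmetric] mult.commute[of k 2])
    also have "\<dots> / ?\<mu> \<le> ?f n"
    proof -
      have "(real k + 1)\<^sup>2 * (real n ^ (2 * k) * real n) \<le> (real k + 1)\<^sup>2 * (exp (B + 2) * ?\<mu>)"
        using \<mu> by (rule mult_left_mono) simp
      then show ?thesis
        using \<mu>0 n by (simp add: pos_divide_le_eq pos_le_divide_eq mult_ac)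
    qed
    finally show ?case by simp
  qed
  show "?f \<longlonglongrightarrow> 0"
    by (intro tendsto_mult_right_zero lim_const_over_n)
qed

section \<open>Evaluation of \<open>(1 - p) ^ M\<close> for the prescribed \<open>p\<close>\<close>

lemma entropy_fun_pos:
  assumes "0 < c" "c < 1"
  shows "entropy_fun c > 0"
proof -
  have "c * ln c < 0" "(1 - c) * ln (1 - c) < 0" using assms by (simp_all add: mult_less_0_iff)
  then show ?thesis by (simp add: entropy_fun_def)
qed

text \<open>This explains the normalisation of \<open>p\<close> for \<open>k > 1\<close>: with
  \<open>w = 1 - c\<close>, \<open>L = ln n\<close> and \<open>Q = q\<close> or
  \<open>Q = - q\<close>, the product of \<open>p\<close> and the leading term
  \<open>(n - t) ^ k / k!\<close> of \<open>M\<close> is exactly the wanted exponent.\<close>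

lemma threshold_scaling:
  fixes w n :: real
  assumes "w > 0" "n > 0" "k > 0"
  shows "1 / n ^ (k - 1) * (A * fact k / w ^ k + Q * (1 / w ^ k) * fact k * (L / n)) * ((w * n) ^ k / fact k)
    = A * n + Q * L"
proof -
  have "n ^ k = n * n ^ (k - 1)" using assms by (cases k) auto
  then show ?thesis using assms by (simp add: power_mult_distrib field_simps)
qed

text \<open>The analogue for \<open>k = 1\<close>, where the prescribed quantity is
  \<open>ln (1 - p)\<close> and \<open>n - t = w * n\<close>.\<close>

lemma threshold_scaling_1:
  fixes w n :: real
  assumes "w > 0" "n > 0"
  shows "w * n * (- A / w + x / (w * n)) = - (A * n) + x"
  using assms by (simp add: field_simps)

text \<open>With \<open>y = k * x \<le> 1\<close>, the power is at most
  \<open>exp y \<le> 1 + y + y ^ 2 \<le> 1 + 2 * y\<close>. It controls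
  \<open>((N + k) / N) ^ k\<close>.\<close>

lemma one_add_power_le:
  fixes x :: real
  assumes "0 \<le> x" "real k * x \<le> 1"
  shows "(1 + x) ^ k \<le> 1 + 2 * real k * x"
proof -
  have "(1 + x) ^ k \<le> exp x ^ k" using assms by (intro power_mono exp_ge_add_one_self) auto
  also have "\<dots> = exp (real k * x)" by (simp add: exp_of_nat_mult)
  also have "\<dots> \<le> 1 + real k * x + (real k * x)\<^sup>2" using assms by (intro exp_bound) auto
  also have "(real k * x)\<^sup>2 \<le> real k * x"
    using assms mult_left_le[of "real k * x" "real k * x"] by (simp add: power2_eq_square)
  finally show ?thesis by (simp add: algebra_simps)
qed

text \<open>Both \<open>1 - p \<le> exp (- p)\<close> and \<open>M \<ge> (n - t) ^ k / k!\<close>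
  point in the useful direction, so no error term appears.\<close>

lemma eventually_upper_threshold:
  assumes c: "0 < c" "c < 1" and t: "\<And>n. t n = nat \<lfloor>c * real n\<rfloor>" and k: "k > 1" and q: "q > 0"
  defines "p \<equiv> (\<lambda>n. 1 / real n ^ (k - 1) * (entropy_fun c * fact k / (1 - c) ^ k
      + q * (1 / (1 - c) ^ k) * fact k * (ln (real n) / real n)))"
  shows "\<forall>\<^sub>F n in integral_multiples c. 0 \<le> p n \<and> p n \<le> 1 \<and>
      (1 - p n) ^ ((n - t n + k) choose k) \<le> exp (- (entropy_fun c * real n) - q * ln (real n))"
proof -
  define C where "C = entropy_fun c * fact k / (1 - c) ^ k"
  define D where "D = q * (1 / (1 - c) ^ k) * fact k"
  have pos: "C > 0" "D > 0" using c q entropy_fun_pos[OF c] by (simp_all add: C_def D_def)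
  have pCD: "p n = 1 / real n ^ (k - 1) * (C + D * (ln (real n) / real n))" for n
    by (simp add: p_def C_def D_def)
  \<comment> \<open>Since \<open>k > 1\<close> gives \<open>n ^ (k - 1) \<ge> n\<close>, this forces
    \<open>p \<le> 1\<close>.\<close>
  have "\<forall>\<^sub>F n in sequentially. (C + D * (ln (real n) / real n)) / real n < 1"
    by real_asymp
  from eventually_integral_multiplesI[OF this] eventually_floor_integral_multiples[OF c, of k]
  show ?thesis
  proof eventually_elim
    case (elim n)
    let ?N = "n - t n"
    have n: "real n \<ge> 1" and N: "real ?N = (1 - c) * real n"
      using elim by (auto simp: t of_nat_diff algebra_simps)
    have num: "0 \<le> C + D * (ln (real n) / real n)" using pos n by simp
    then have p0: "0 \<le> p n" by (simp add: pCD)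
    have "p n \<le> (C + D * (ln (real n) / real n)) / real n"
    proof -
      have "real n ^ 1 \<le> real n ^ (k - 1)" using n k by (intro power_increasing) auto
      then have "p n \<le> 1 / real n * (C + D * (ln (real n) / real n))"
        unfolding pCD using num n by (intro mult_right_mono divide_left_mono) auto
      then show ?thesis by simp
    qed
    with elim have p1: "p n \<le> 1" by linarith
    have "entropy_fun c * real n + q * ln (real n) = p n * (real ?N ^ k / fact k)"
      unfolding p_def N using c n k by (subst threshold_scaling) auto
    also have "\<dots> \<le> p n * real ((?N + k) choose k)"
      using p0 power_le_choose_add[of ?N k] by (intro mult_left_mono) (auto simp: field_simps)
    finally have le: "entropy_fun c * real n + q * ln (real n) \<le> p n * real ((?N + k) choose k)" .
    have "(1 - p n) ^ ((?N + k) choose k) \<le> exp (- p n) ^ ((?N + k) choose k)"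
      using p1 exp_ge_add_one_self[of "- p n"] by (intro power_mono) auto
    also have "\<dots> = exp (- (p n * real ((?N + k) choose k)))"
      by (simp add: mult.commute flip: exp_of_nat_mult)
    also have "\<dots> \<le> exp (- (entropy_fun c * real n) - q * ln (real n))"
      using le by simp
    finally show ?case using p0 p1 by simp
  qed
qed

text \<open>Here \<open>M\<close> must be bounded above and \<open>ln (1 - p)\<close> below. The
  relative error in \<open>M\<close> is \<open>O(1 / n)\<close> and that in the logarithm is
  \<open>O(p) = O(1 / n)\<close>; as \<open>p * M = O(n)\<close>, the exponent loses only a constant
  \<open>B\<close>.\<close>

lemma eventually_lower_threshold:
  assumes c: "0 < c" "c < 1" and t: "\<And>n. t n = nat \<lfloor>c * real n\<rfloor>" and k: "k > 1" and q: "q > 0"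
  defines "p \<equiv> (\<lambda>n. 1 / real n ^ (k - 1) * (entropy_fun c * fact k / (1 - c) ^ k
      - q * (1 / (1 - c) ^ k) * fact k * (ln (real n) / real n)))"
  shows "\<exists>B. \<forall>\<^sub>F n in integral_multiples c. 0 \<le> p n \<and> p n < 1 \<and>
      exp (- (entropy_fun c * real n) + q * ln (real n) - B) \<le> (1 - p n) ^ ((n - t n + k) choose k)"
proof -
  define C where "C = entropy_fun c * fact k / (1 - c) ^ k"
  define D where "D = q * (1 / (1 - c) ^ k) * fact k"
  \<comment> \<open>Chosen so that \<open>one_add_power_le\<close> with
    \<open>x = k / (n - t)\<close> gives \<open>1 + b / n\<close>.\<close>
  define b where "b = 2 * real k * (real k / (1 - c))"
  let ?\<alpha> = "entropy_fun c"
  have \<alpha>: "?\<alpha> > 0" using entropy_fun_pos[OF c] .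
  have pos: "C > 0" "D > 0" "b > 0" using c q k \<alpha> by (simp_all add: C_def D_def b_def)
  have pCD: "p n = 1 / real n ^ (k - 1) * (C - D * (ln (real n) / real n))" for n
    by (simp add: p_def C_def D_def)
  \<comment> \<open>The three conditions ensure, in turn, \<open>p \<ge> 0\<close>,
    \<open>p \<le> 1 / 2\<close> for the logarithm bound, and \<open>k * x \<le> 1\<close> for
    \<open>one_add_power_le\<close>.\<close>
  have "\<forall>\<^sub>F n in sequentially. C - D * (ln (real n) / real n) > 0"
    using pos by real_asymp
  moreover have "\<forall>\<^sub>F n in sequentially. C / real n < 1 / 2"
    by real_asymp
  moreover have "\<forall>\<^sub>F n in sequentially. b / real n < 1"
    by real_asymp
  ultimately have "\<forall>\<^sub>F n in sequentially. C - D * (ln (real n) / real n) > 0 \<and> C / real n < 1 / 2 \<and> b / real n < 1"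
    by eventually_elim simp
  \<comment> \<open>In the constant below, \<open>\<alpha> * b\<close> comes from the correction to
    \<open>M\<close>, and the remaining term bounds \<open>2 * p ^ 2 * M\<close>.\<close>
  from eventually_integral_multiplesI[OF this] eventually_floor_integral_multiples[OF c, of k]
  have "\<forall>\<^sub>F n in integral_multiples c. 0 \<le> p n \<and> p n < 1 \<and>
      exp (- (?\<alpha> * real n) + q * ln (real n) - (?\<alpha> * b + 2 * C * (?\<alpha> + ?\<alpha> * b))) \<le> (1 - p n) ^ ((n - t n + k) choose k)"
  proof eventually_elim
    case (elim n)
    let ?N = "n - t n"
    let ?M = "real ((?N + k) choose k)"
    have n: "real n \<ge> 1" and N: "real ?N = (1 - c) * real n"
      using elim by (auto simp: t of_nat_diff algebra_simps)
    have N0: "real ?N > 0" using N n c by simp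
    have p0: "0 \<le> p n" using elim by (simp add: pCD)
    have pC: "p n \<le> C / real n"
    proof -
      have "real n ^ 1 \<le> real n ^ (k - 1)" using n k by (intro power_increasing) auto
      then have "p n \<le> 1 / real n * (C - D * (ln (real n) / real n))"
        unfolding pCD using elim n by (intro mult_right_mono divide_left_mono) auto
      also have "\<dots> \<le> 1 / real n * C" using n pos by (intro mult_left_mono) auto
      finally show ?thesis by simp
    qed
    with elim have p2: "p n \<le> 1 / 2" by linarith
    have scale: "p n * (real ?N ^ k / fact k) = ?\<alpha> * real n - q * ln (real n)"
      using threshold_scaling[of "1 - c" "real n" k ?\<alpha> "- q" "ln (real n)"] c n k
      unfolding p_def N by simp
    have pM: "p n * ?M \<le> ?\<alpha> * real n - q * ln (real n) + ?\<alpha> * b"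
    proof -
      have "?M * fact k \<le> real (?N + k) ^ k"
        using binomial_fact_pow[of "?N + k" k] by (metis of_nat_fact of_nat_le_iff of_nat_mult of_nat_power)
      also have "real (?N + k) = real ?N * (1 + real k / real ?N)"
        using N0 by (simp add: field_simps)
      also have "(real ?N * (1 + real k / real ?N)) ^ k = real ?N ^ k * (1 + real k / real ?N) ^ k"
        by (rule power_mult_distrib)
      also have "\<dots> \<le> real ?N ^ k * (1 + b / real n)"
      proof (rule mult_left_mono)
        define x where "x = real k / real ?N"
        have "2 * (real k * x) = b / real n"
          unfolding x_def N b_def using c n by (simp add: field_simps)
        moreover have "b / real n < 1" using elim by blast
        moreover have "x \<ge> 0" by (simp add: x_def)
        ultimately show "(1 + real k / real ?N) ^ k \<le> 1 + b / real n"
          using one_add_power_le[of x k] unfolding x_def[symmetric] by (simp add: mult.assoc)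
      qed simp
      finally have "?M \<le> real ?N ^ k / fact k * (1 + b / real n)"
        by (simp add: pos_le_divide_eq)
      then have "p n * ?M \<le> p n * (real ?N ^ k / fact k * (1 + b / real n))"
        using p0 by (rule mult_left_mono)
      also have "\<dots> = (?\<alpha> * real n - q * ln (real n)) * (1 + b / real n)"
        by (simp only: scale[symmetric] mult.assoc)
      also have "\<dots> = ?\<alpha> * real n - q * ln (real n) + ?\<alpha> * b - q * ln (real n) * (b / real n)"
        using n by (simp add: field_simps)
      also have "\<dots> \<le> ?\<alpha> * real n - q * ln (real n) + ?\<alpha> * b"
        using q n pos by simp
      finally show ?thesis .
    qed
    have ppM: "p n * (p n * ?M) \<le> C * (?\<alpha> + ?\<alpha> * b)"
    proof -
      have "p n * ?M \<le> ?\<alpha> * real n + ?\<alpha> * b"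
      proof -
        have "0 \<le> q * ln (real n)" using q n by simp
        with pM show ?thesis by linarith
      qed
      also have "\<dots> \<le> ?\<alpha> * real n + ?\<alpha> * b * real n"
        using n \<alpha> pos mult_left_mono[of 1 "real n" "?\<alpha> * b"] by simp
      finally have le: "p n * ?M \<le> (?\<alpha> + ?\<alpha> * b) * real n" by (simp add: algebra_simps)
      have "p n * (p n * ?M) \<le> C / real n * ((?\<alpha> + ?\<alpha> * b) * real n)"
        by (rule mult_mono[OF pC le]) (use p0 pos n in auto)
      then show ?thesis using n by simp
    qed
    have "exp (- (?\<alpha> * real n) + q * ln (real n) - (?\<alpha> * b + 2 * C * (?\<alpha> + ?\<alpha> * b)))
        \<le> exp (?M * (- p n - 2 * (p n)\<^sup>2))"
      using pM ppM by (simp add: power2_eq_square algebra_simps)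
    \<comment> \<open>For \<open>0 \<le> p \<le> 1 / 2\<close>,
      \<open>ln (1 - p) \<ge> - p - 2 * p ^ 2\<close>.\<close>
    also have "\<dots> \<le> exp (?M * ln (1 - p n))"
      using ln_one_minus_pos_lower_bound[OF p0 p2] by (simp add: mult_left_mono)
    also have "\<dots> = (1 - p n) ^ ((?N + k) choose k)"
      using p2 by (simp add: exp_of_nat_mult)
    finally show ?case using p0 p2 by simp
  qed
  then show ?thesis by blast
qed

text \<open>For \<open>k = 1\<close>, \<open>1 - p\<close> is exactly \<open>exp e\<close> and
  \<open>M = (n - t) + 1\<close>. The first \<open>n - t\<close> coins give the claimed bound, and
  the extra factor \<open>exp e\<close> is at most 1.\<close>

lemma eventually_upper_threshold_1:
  assumes c: "0 < c" "c < 1" and t: "\<And>n. t n = nat \<lfloor>c * real n\<rfloor>" and q: "q > 0"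
  defines "p \<equiv> (\<lambda>n. 1 - exp (- entropy_fun c / (1 - c) - q * ln (real n) / ((1 - c) * real n)))"
  shows "\<forall>\<^sub>F n in integral_multiples c. 0 \<le> p n \<and> p n \<le> 1 \<and>
      (1 - p n) ^ ((n - t n + 1) choose 1) \<le> exp (- (entropy_fun c * real n) - q * ln (real n))"
  using eventually_floor_integral_multiples[OF c, of 0]
proof eventually_elim
  case (elim n)
  define e where "e = - entropy_fun c / (1 - c) - q * ln (real n) / ((1 - c) * real n)"
  have n: "real n \<ge> 1" and N: "real (n - t n) = (1 - c) * real n"
    using elim by (auto simp: t of_nat_diff algebra_simps)
  have e: "e \<le> 0"
  proof -
    have "0 \<le> entropy_fun c / (1 - c)" "0 \<le> q * ln (real n) / ((1 - c) * real n)"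
      using entropy_fun_pos[OF c] c q n by simp_all
    then show ?thesis unfolding e_def minus_divide_left[symmetric] by linarith
  qed
  have p: "p n = 1 - exp e" unfolding p_def e_def ..
  have "(1 - p n) ^ ((n - t n + 1) choose 1) = exp (real (n - t n) * e + e)"
    by (simp add: p exp_add exp_of_nat_mult)
  also have "\<dots> \<le> exp (real (n - t n) * e)" using e by simp
  also have "real (n - t n) * e = - (entropy_fun c * real n) - q * ln (real n)"
    using threshold_scaling_1[of "1 - c" "real n" "entropy_fun c" "- (q * ln (real n))"] c n
    by (simp add: N e_def)
  finally show ?case using e by (simp add: p)
qed

text \<open>The extra coin now costs a factor \<open>exp e\<close>, which is at least
  \<open>exp (- \<alpha>(c) / (1 - c))\<close>; this is the constant subtracted in the
  exponent.\<close>

lemma eventually_lower_threshold_1: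
  assumes c: "0 < c" "c < 1" and t: "\<And>n. t n = nat \<lfloor>c * real n\<rfloor>" and q: "q > 0"
  defines "p \<equiv> (\<lambda>n. 1 - exp (- entropy_fun c / (1 - c) + q * ln (real n) / ((1 - c) * real n)))"
  shows "\<forall>\<^sub>F n in integral_multiples c. 0 \<le> p n \<and> p n < 1 \<and>
      exp (- (entropy_fun c * real n) + q * ln (real n) - entropy_fun c / (1 - c))
        \<le> (1 - p n) ^ ((n - t n + 1) choose 1)"
proof -
  have "- entropy_fun c / (1 - c) < 0" "1 - c > 0" using entropy_fun_pos[OF c] c by simp_all
  \<comment> \<open>The \<open>ln n / n\<close> term vanishes in the limit, so the exponent is
    eventually negative and \<open>p\<close> lies between 0 and 1.\<close>
  then have "\<forall>\<^sub>F n in sequentially. - entropy_fun c / (1 - c) + q * ln (real n) / ((1 - c) * real n) < 0"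
    by real_asymp
  from eventually_integral_multiplesI[OF this] eventually_floor_integral_multiples[OF c, of 0]
  show ?thesis
  proof eventually_elim
    case (elim n)
    define e where "e = - entropy_fun c / (1 - c) + q * ln (real n) / ((1 - c) * real n)"
    have n: "real n \<ge> 1" and N: "real (n - t n) = (1 - c) * real n"
      using elim by (auto simp: t of_nat_diff algebra_simps)
    have p: "p n = 1 - exp e" unfolding p_def e_def ..
    have "real (n - t n) * e = - (entropy_fun c * real n) + q * ln (real n)"
      using threshold_scaling_1[of "1 - c" "real n" "entropy_fun c" "q * ln (real n)"] c n
      by (simp add: N e_def)
    moreover have "- entropy_fun c / (1 - c) \<le> e" using c q n by (simp add: e_def)
    ultimately have "exp (- (entropy_fun c * real n) + q * ln (real n) - entropy_fun c / (1 - c))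
        \<le> exp (real (n - t n) * e + e)"
      by simp
    also have "\<dots> = (1 - p n) ^ ((n - t n + 1) choose 1)"
      by (simp add: p exp_add exp_of_nat_mult)
    finally have "exp (- (entropy_fun c * real n) + q * ln (real n) - entropy_fun c / (1 - c))
        \<le> (1 - p n) ^ ((n - t n + 1) choose 1)" .
    moreover have "e < 0" unfolding e_def using elim by blast
    ultimately show ?case by (simp add: p)
  qed
qed

theorem theorem5:
  fixes c :: real and k :: nat and t t' :: "nat \<Rightarrow> nat"
  assumes "0 < c" and "c < 1" and "k \<ge> 1"
    and t: "\<And>n. t n = nat \<lfloor>c * real n\<rfloor>"
    and t': "\<And>n. t' n = t n - k"
  shows "\<exists>q0>0. \<forall>q\<ge>q0.
    (k > 1 \<longrightarrow>
      (let C = entropy_fun c * fact k / (1 - c) ^ k;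
           d = (\<lambda>n::nat. q * (1 / (1 - c) ^ k) * fact k * (ln (real n) / real n));
           p_upper = (\<lambda>n::nat. 1 / real n ^ (k - 1) * (C + d n));
           p_lower = (\<lambda>n::nat. 1 / real n ^ (k - 1) * (C - d n))
       in with_high_probability c (\<lambda>n. random_pure_complex n (t n) (p_upper n))
            (\<lambda>n \<Delta>. complete_skeleton n (t' n) \<Delta>) \<and>
          with_high_probability c (\<lambda>n. random_pure_complex n (t n) (p_lower n))
            (\<lambda>n \<Delta>. \<not> complete_skeleton n (t' n) \<Delta>))) \<and>
    (k = 1 \<longrightarrow>
      (let a = - entropy_fun c / (1 - c);
           d = (\<lambda>n::nat. q * ln (real n) / ((1 - c) * real n));
           p_upper = (\<lambda>n::nat. 1 - exp (a - d n));
           p_lower = (\<lambda>n::nat. 1 - exp (a + d n))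
       in with_high_probability c (\<lambda>n. random_pure_complex n (t n) (p_upper n))
            (\<lambda>n \<Delta>. complete_skeleton n (t' n) \<Delta>) \<and>
          with_high_probability c (\<lambda>n. random_pure_complex n (t n) (p_lower n))
            (\<lambda>n \<Delta>. \<not> complete_skeleton n (t' n) \<Delta>)))"
proof -
  let ?Y = "\<lambda>p. with_high_probability c (\<lambda>n. random_pure_complex n (t n) (p n)) (\<lambda>n \<Delta>. complete_skeleton n (t' n) \<Delta>)"
  let ?N = "\<lambda>p. with_high_probability c (\<lambda>n. random_pure_complex n (t n) (p n)) (\<lambda>n \<Delta>. \<not> complete_skeleton n (t' n) \<Delta>)"
  note c = assms(1,2)
  have large: "?Y (\<lambda>n. 1 / real n ^ (k - 1) * (entropy_fun c * fact k / (1 - c) ^ k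
      + q * (1 / (1 - c) ^ k) * fact k * (ln (real n) / real n)))"
    "?N (\<lambda>n. 1 / real n ^ (k - 1) * (entropy_fun c * fact k / (1 - c) ^ k
      - q * (1 / (1 - c) ^ k) * fact k * (ln (real n) / real n)))"
    if q3: "q \<ge> 3 * real k + 3" and k: "k > 1" for q
  proof -
    have q: "q > 0" using q3 by simp
    show "?Y (\<lambda>n. 1 / real n ^ (k - 1) * (entropy_fun c * fact k / (1 - c) ^ k
      + q * (1 / (1 - c) ^ k) * fact k * (ln (real n) / real n)))"
      unfolding t'
      by (rule with_high_probability_complete_skeleton[OF c t q])
         (rule eventually_upper_threshold[OF c t k q])
    obtain B where "\<forall>\<^sub>F n in integral_multiples c.
      0 \<le> 1 / real n ^ (k - 1) * (entropy_fun c * fact k / (1 - c) ^ k - q * (1 / (1 - c) ^ k) * fact k * (ln (real n) / real n)) \<and>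
      1 / real n ^ (k - 1) * (entropy_fun c * fact k / (1 - c) ^ k - q * (1 / (1 - c) ^ k) * fact k * (ln (real n) / real n)) < 1 \<and>
      exp (- (entropy_fun c * real n) + q * ln (real n) - B) \<le>
        (1 - 1 / real n ^ (k - 1) * (entropy_fun c * fact k / (1 - c) ^ k - q * (1 / (1 - c) ^ k) * fact k * (ln (real n) / real n))) ^ ((n - t n + k) choose k)"
      using eventually_lower_threshold[OF c t k q] by blast
    then show "?N (\<lambda>n. 1 / real n ^ (k - 1) * (entropy_fun c * fact k / (1 - c) ^ k
      - q * (1 / (1 - c) ^ k) * fact k * (ln (real n) / real n)))"
      unfolding t' by (rule with_high_probability_not_complete_skeleton[OF c t q3])
  qed
  have one: "?Y (\<lambda>n. 1 - exp (- entropy_fun c / (1 - c) - q * ln (real n) / ((1 - c) * real n)))"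
    "?N (\<lambda>n. 1 - exp (- entropy_fun c / (1 - c) + q * ln (real n) / ((1 - c) * real n)))"
    if q3: "q \<ge> 3 * real k + 3" and k: "k = 1" for q
  proof -
    have q: "q > 0" using q3 by simp
    show "?Y (\<lambda>n. 1 - exp (- entropy_fun c / (1 - c) - q * ln (real n) / ((1 - c) * real n)))"
      unfolding t' k
      by (rule with_high_probability_complete_skeleton[OF c t q])
         (rule eventually_upper_threshold_1[OF c t q])
    show "?N (\<lambda>n. 1 - exp (- entropy_fun c / (1 - c) + q * ln (real n) / ((1 - c) * real n)))"
      unfolding t' k
      by (rule with_high_probability_not_complete_skeleton[OF c t q3[unfolded k]])
         (rule eventually_lower_threshold_1[OF c t q])
  qed
  \<comment> \<open>The threshold \<open>q0 = 3 * k + 3\<close> is what the second moment half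
    demands; it also gives the \<open>q > 0\<close> of the first.\<close>
  show ?thesis
    unfolding Let_def using large one
    by (intro exI[of _ "3 * real k + 3"] conjI allI impI) auto
qed

end
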